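(* Let $\mathbf{P}=(p_1,p_2,p_3)$ be a triangle inscribed in the unit circle, regarded as an ideal hyperbolic triangle with sides $\xi_1,\xi_2,\xi_3$, and let $$S_{\mathbf{P}}=\left(\frac{I_{\mathbf{P}}-K_{\mathbf{P}}}{I_{\mathbf{P}}+K_{\mathbf{P}}},\ \frac{2J_{\mathbf{P}}}{I_{\mathbf{P}}+K_{\mathbf{P}}}\right).$$ Then $S_{\mathbf{P}}$ minimizes the sum of the hyperbolic sines of the hyperbolic distances to the sides, i.e. the function $X\mapsto \sum_{\ell=1}^{3}\sinh\bigl(d_{\mathcal K}(X,\xi_\ell)\bigr)$ on $\mathbb{H}$ attains its minimum at $X=S_{\mathbf{P}}$.
   Context: $\mathbb{H}$ is the open unit disc with the Klein–Beltrami metric $d_{\mathcal K}(X,Y)=\cosh^{-1}\frac{1-X\cdot Y}{\sqrt{(1-|X|^2)(1-|Y|^2)}}$; geodesics are the open chords, and $d_{\mathcal K}(X,\xi)$ is the hyperbolic distance from $X$ to the geodesic $\xi$. The unit circle is identified with $\mathbb{RP}^1=\mathbb{R}\cup\{\infty\}$ by $p\mapsto P=\left(\frac{1-p^2}{1+p^2},\frac{2p}{1+p^2}\right)$, $\infty\mapsto(-1,0)$. The triangle $\mathbf{P}=(p_1,p_2,p_3)$ is given by three pairwise distinct points $p_\ell\in\mathbb{RP}^1$; its vertices are the corresponding points $P_\ell$ and its sides are the geodesics $\xi_\ell=P_\ell P_{\ell+1}$ (indices modulo $3$). Further $$I_{\mathbf{P}}=\sum_{\ell=1}^3\frac{1}{p_\ell-p_{\ell+1}},\quad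 J_{\mathbf{P}}=\frac12\sum_{\ell=1}^3\frac{p_\ell+p_{\ell+1}}{p_\ell-p_{\ell+1}},\quad K_{\mathbf{P}}=\sum_{\ell=1}^3\frac{p_\ell p_{\ell+1}}{p_\ell-p_{\ell+1}},$$ where, if one of the $p_\ell$ is $\infty$, each summand is replaced by its limit. *)

theory Defs
  imports "HOL-Analysis.Analysis"
begin

datatype rp1 = Affine real | Infinity

fun circle_point :: "rp1 \<Rightarrow> real \<times> real" where
  "circle_point (Affine p) = ((1 - p\<^sup>2) / (1 + p\<^sup>2), 2 * p / (1 + p\<^sup>2))"
| "circle_point Infinity = (-1, 0)"

definition klein_disc :: "(real \<times> real) set" where
  "klein_disc = ball 0 1"

definition klein_dist :: "real \<times> real \<Rightarrow> real \<times> real \<Rightarrow> real" where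
  "klein_dist X Y = arcosh ((1 - X \<bullet> Y) / sqrt ((1 - (norm X)\<^sup>2) * (1 - (norm Y)\<^sup>2)))"

definition klein_infdist :: "real \<times> real \<Rightarrow> (real \<times> real) set \<Rightarrow> real" where
  "klein_infdist X \<xi> = (INF Y\<in>\<xi>. klein_dist X Y)"

text \<open>
  A triangle is an injective map from the index type \<open>3\<close>, whose addition is modulo 3:
  \<open>3 = 0\<close>, so the vertices are \<open>p 1\<close>, \<open>p 2\<close>, \<open>p 3\<close> and \<open>p (3 + 1) = p 1\<close>.
\<close>

definition side :: "(3 \<Rightarrow> rp1) \<Rightarrow> 3 \<Rightarrow> (real \<times> real) set" where
  "side p l = open_segment (circle_point (p l)) (circle_point (p (l + 1)))"

text \<open>
  Extension of an expression in two real parameters to distinct points of the projective line,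
  by taking the limit when one parameter tends to infinity (from both ends of the real line,
  since \<open>at_infinity\<close> is the filter of large absolute value). Two infinite
  arguments do not occur in a triangle; the value there is arbitrary.
\<close>

fun rp1_extend :: "(real \<Rightarrow> real \<Rightarrow> real) \<Rightarrow> rp1 \<Rightarrow> rp1 \<Rightarrow> real" where
  "rp1_extend f (Affine p) (Affine q) = f p q"
| "rp1_extend f Infinity (Affine q) = Lim at_infinity (\<lambda>t. f t q)"
| "rp1_extend f (Affine p) Infinity = Lim at_infinity (\<lambda>t. f p t)"
| "rp1_extend f Infinity Infinity = 0"

definition I_sum :: "(3 \<Rightarrow> rp1) \<Rightarrow> real" where
  "I_sum p = (\<Sum>l\<in>UNIV. rp1_extend (\<lambda>x y. 1 / (x - y)) (p l) (p (l + 1)))"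

definition J_sum :: "(3 \<Rightarrow> rp1) \<Rightarrow> real" where
  "J_sum p = 1 / 2 * (\<Sum>l\<in>UNIV. rp1_extend (\<lambda>x y. (x + y) / (x - y)) (p l) (p (l + 1)))"

definition K_sum :: "(3 \<Rightarrow> rp1) \<Rightarrow> real" where
  "K_sum p = (\<Sum>l\<in>UNIV. rp1_extend (\<lambda>x y. x * y / (x - y)) (p l) (p (l + 1)))"

definition S_point :: "(3 \<Rightarrow> rp1) \<Rightarrow> real \<times> real" where
  "S_point p = ((I_sum p - K_sum p) / (I_sum p + K_sum p), 2 * J_sum p / (I_sum p + K_sum p))"

text \<open>The limits above exist, so that \<open>Lim\<close> takes the intended values.\<close>

lemma tendsto_summands:
  fixes a :: real
  shows "((\<lambda>t. 1 / (t - a)) \<longlongrightarrow> 0) at_infinity"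
    and "((\<lambda>t. 1 / (a - t)) \<longlongrightarrow> 0) at_infinity"
    and "((\<lambda>t. (t + a) / (t - a)) \<longlongrightarrow> 1) at_infinity"
    and "((\<lambda>t. (a + t) / (a - t)) \<longlongrightarrow> -1) at_infinity"
    and "((\<lambda>t. t * a / (t - a)) \<longlongrightarrow> a) at_infinity"
    and "((\<lambda>t. a * t / (a - t)) \<longlongrightarrow> -a) at_infinity"
proof -
  have inv: "((\<lambda>t. 1 / (t - a)) \<longlongrightarrow> 0) at_infinity"
  proof -
    have "filterlim (\<lambda>t. t + (- a)) at_infinity at_infinity"
      by (rule tendsto_add_filterlim_at_infinity') (auto simp: filterlim_ident)
    from filterlim_compose[OF tendsto_inverse_0 this] show ?thesis
      by (simp add: field_simps)
  qed
  show "((\<lambda>t. 1 / (t - a)) \<longlongrightarrow> 0) at_infinity" by (fact inv)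
  show "((\<lambda>t. 1 / (a - t)) \<longlongrightarrow> 0) at_infinity"
    using tendsto_minus[OF inv] by (simp add: minus_divide_right)
  have ev: "\<forall>\<^sub>F t in at_infinity. t \<noteq> a"
    unfolding eventually_at_infinity by (rule exI[of _ "\<bar>a\<bar> + 1"]) auto
  have *: "((\<lambda>t. c + d * (1 / (t - a))) \<longlongrightarrow> c) at_infinity" for c d :: real
    using tendsto_add[OF tendsto_const tendsto_mult_right_zero[OF inv], of c d] by simp
  show "((\<lambda>t. (t + a) / (t - a)) \<longlongrightarrow> 1) at_infinity"
    by (rule Lim_transform_eventually[OF *[of 1 "2 * a"]], rule eventually_mono[OF ev])
       (simp add: field_simps)
  show "((\<lambda>t. (a + t) / (a - t)) \<longlongrightarrow> -1) at_infinity"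
    by (rule Lim_transform_eventually[OF *[of "-1" "- 2 * a"]], rule eventually_mono[OF ev])
       (simp add: field_simps)
  show "((\<lambda>t. t * a / (t - a)) \<longlongrightarrow> a) at_infinity"
    by (rule Lim_transform_eventually[OF *[of a "a\<^sup>2"]], rule eventually_mono[OF ev])
       (simp add: field_simps power2_eq_square)
  show "((\<lambda>t. a * t / (a - t)) \<longlongrightarrow> -a) at_infinity"
    by (rule Lim_transform_eventually[OF *[of "- a" "- (a\<^sup>2)"]], rule eventually_mono[OF ev])
       (simp add: field_simps power2_eq_square)
qed

lemmas Lim_summands = tendsto_summands[THEN tendsto_Lim[OF trivial_limit_at_infinity]]

text \<open>The denominators in \<open>S_point\<close> do not vanish.\<close>

lemma I_sum_plus_K_sum_nonzero:
  assumes "inj p"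
  shows "I_sum p + K_sum p \<noteq> 0"
proof -
  have two: "rp1_extend (\<lambda>x y. 1 / (x - y)) a b + rp1_extend (\<lambda>x y. x * y / (x - y)) a b
      = (case (a, b) of (Affine x, Affine y) \<Rightarrow> (1 + x * y) / (x - y)
         | (Infinity, Affine y) \<Rightarrow> y | (Affine x, Infinity) \<Rightarrow> - x | _ \<Rightarrow> 0)" for a b
    by (cases a; cases b) (simp_all add: Lim_summands add_divide_distrib)
  define c where "c a b = (case (a, b) of (Affine x, Affine y) \<Rightarrow> (1 + x * y) / (x - y)
         | (Infinity, Affine y) \<Rightarrow> y | (Affine x, Infinity) \<Rightarrow> - x | _ \<Rightarrow> 0)" for a b :: rp1
  have sum: "I_sum p + K_sum p = c (p 1) (p 2) + c (p 2) (p 3) + c (p 3) (p 1)"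
  proof -
    have "p 4 = p 1"
      by (rule arg_cong[where f = p]) simp
    then show ?thesis
      unfolding I_sum_def K_sum_def sum_3 c_def two[symmetric] by simp
  qed
  have d: "p 1 \<noteq> p 2" "p 2 \<noteq> p 3" "p 3 \<noteq> p 1"
    using assms by (auto dest: injD)
  have one: "c x y * c y z + c y z * c z x + c z x * c x y = 1"
    if "x \<noteq> y" "y \<noteq> z" "z \<noteq> x" for x y z
    using that by (cases x; cases y; cases z) (auto simp: c_def divide_simps, (simp add: algebra_simps)+)
  have sq: "(u + v + w)\<^sup>2 = u\<^sup>2 + v\<^sup>2 + w\<^sup>2 + 2 * (u * v + v * w + w * u)" for u v w :: real
    by (simp add: power2_eq_square algebra_simps)
  have "(I_sum p + K_sum p)\<^sup>2 \<ge> 2"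
    unfolding sum sq one[OF d] by simp
  then show ?thesis by auto
qed

end

theory Submission
  imports Defs
begin

text \<open>
  In the hyperboloid model the disc point \<open>X\<close> is the unit timelike vector
  \<open>(1, X) / sqrt (1 - \<bar>X\<bar>\<^sup>2)\<close>, and a geodesic is the Minkowski-orthogonal complement of a unit
  spacelike vector \<open>n\<close>; the hyperbolic sine of the distance from a point to the geodesic is the
  absolute value of the Minkowski product of the point with \<open>n\<close> (lemma \<open>sinh_infdist_side\<close>).
  For the chord with parameters \<open>p\<close> and \<open>q\<close> one has
  \<open>n = (1 + p q, 1 - p q, p + q) / (p - q)\<close>, so that the three normals of the triangle add up to
  \<open>N = (I + K, I - K, 2 J)\<close>, and \<open>S\<close> is the point of the disc on the line spanned by \<open>N\<close>.

  Each normal has Minkowski square \<open>-1\<close>, and two normals of the same triangle have product \<open>1\<close>: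
  its absolute value is \<open>1\<close> because the geodesics share an ideal endpoint, and the sign comes from
  the cyclic order of the vertices (lemma \<open>normal_product_adjacent\<close>). Hence \<open>N\<close> has product \<open>1\<close> with each normal and
  square \<open>3\<close>. The triangle inequality bounds the sum of the hyperbolic sines from below by the
  absolute value of the product of the point with \<open>N\<close>, and the reversed Cauchy-Schwarz
  inequality for timelike vectors (lemma \<open>reversed_Cauchy_Schwarz\<close>) bounds that by \<open>sqrt 3\<close>. At \<open>S\<close> the three signed
  products agree, each being \<open>1 / sqrt 3\<close> up to a common sign, so the bound is attained.
\<close>

section \<open>The distance from a point to a chord\<close>

text \<open>
  On the chord, \<open>1 - \<bar>Y\<bar>\<^sup>2\<close> is a multiple of \<open>t (1 - t)\<close> and \<open>1 - X \<bullet> Y\<close> is a convex combination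
  of its two end values, so the distance is minimized by the inequality of the arithmetic and
  geometric means. The hypothesis on \<open>s\<close> says that the resulting minimum of the hyperbolic cosine
  is \<open>sqrt (1 + s\<^sup>2)\<close>.
\<close>

lemma sinh_klein_infdist_chord:
  fixes X P Q :: "real \<times> real"
  assumes X: "norm X < 1" and P: "norm P = 1" and Q: "norm Q = 1" and PQ: "P \<noteq> Q"
    and s: "2 * (1 - X \<bullet> P) * (1 - X \<bullet> Q) = (1 - (norm X)\<^sup>2) * (1 - P \<bullet> Q) * (1 + s\<^sup>2)"
  shows "sinh (klein_infdist X (open_segment P Q)) = \<bar>s\<bar>"
proof -
  define \<alpha> where "\<alpha> = 1 - X \<bullet> P"
  define \<beta> where "\<beta> = 1 - X \<bullet> Q"
  define c where "c = 1 - P \<bullet> Q"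
  define w where "w = 1 - (norm X)\<^sup>2"
  have \<alpha>: "\<alpha> > 0"
    using norm_cauchy_schwarz[of X P] X P by (simp add: \<alpha>_def)
  have \<beta>: "\<beta> > 0"
    using norm_cauchy_schwarz[of X Q] X Q by (simp add: \<beta>_def)
  have w: "w > 0"
    using X by (simp add: w_def power_less_one_iff)
  have PP: "P \<bullet> P = 1" and QQ: "Q \<bullet> Q = 1"
    using P Q by (simp_all add: dot_square_norm)
  have "(norm (P - Q))\<^sup>2 = 2 * c"
    by (simp add: power2_norm_eq_inner inner_diff PP QQ c_def inner_commute)
  moreover have "(norm (P - Q))\<^sup>2 > 0"
    using PQ by simp
  ultimately have c: "c > 0" by linarith
  have s': "2 * \<alpha> * \<beta> = w * c * (1 + s\<^sup>2)"
    using s by (simp add: \<alpha>_def \<beta>_def c_def w_def)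
  define Y where "Y t = (1 - t) *\<^sub>R P + t *\<^sub>R Q" for t
  have dist: "klein_dist X (Y t) = arcosh (((1 - t) * \<alpha> + t * \<beta>) / sqrt (2 * w * c * (t * (1 - t))))"
    for t
  proof -
    have "(norm (Y t))\<^sup>2 = (1 - t)\<^sup>2 + t\<^sup>2 + 2 * t * (1 - t) * (P \<bullet> Q)"
      unfolding power2_norm_eq_inner Y_def
      by (simp add: inner_add PP QQ inner_commute[of Q P] power2_eq_square) (simp add: algebra_simps)
    then have "1 - (norm (Y t))\<^sup>2 = 2 * c * (t * (1 - t))"
      by (simp add: c_def power2_eq_square algebra_simps)
    moreover have "1 - X \<bullet> Y t = (1 - t) * \<alpha> + t * \<beta>"
      by (simp add: Y_def \<alpha>_def \<beta>_def inner_add algebra_simps)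
    ultimately show ?thesis
      unfolding klein_dist_def w_def[symmetric] by (simp only: mult_ac)
  qed
  have seg: "open_segment P Q = Y ` {0<..<1}"
    using PQ by (auto simp: in_segment Y_def)
  define m where "m = sqrt (1 + s\<^sup>2)"
  have m1: "m \<ge> 1" by (simp add: m_def)
  have pos: "2 * w * c * (t * (1 - t)) > 0" and sq: "(m * sqrt (2 * w * c * (t * (1 - t))))\<^sup>2 = 4 * ((1 - t) * \<alpha>) * (t * \<beta>)"
    if t: "0 < t" "t < 1" for t
  proof -
    show pos: "2 * w * c * (t * (1 - t)) > 0"
      using t w c by simp
    have "(m * sqrt (2 * w * c * (t * (1 - t))))\<^sup>2 = (1 + s\<^sup>2) * (2 * w * c * (t * (1 - t)))"
      using pos by (simp add: power_mult_distrib m_def)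
    also have "\<dots> = 2 * (w * c * (1 + s\<^sup>2)) * (t * (1 - t))"
      by (simp only: mult_ac)
    also have "\<dots> = 4 * ((1 - t) * \<alpha>) * (t * \<beta>)"
      unfolding s'[symmetric] by simp
    finally show "(m * sqrt (2 * w * c * (t * (1 - t))))\<^sup>2 = 4 * ((1 - t) * \<alpha>) * (t * \<beta>)" .
  qed
  have lower: "m \<le> ((1 - t) * \<alpha> + t * \<beta>) / sqrt (2 * w * c * (t * (1 - t)))"
    if t: "0 < t" "t < 1" for t
  proof -
    have "(m * sqrt (2 * w * c * (t * (1 - t))))\<^sup>2 \<le> ((1 - t) * \<alpha> + t * \<beta>)\<^sup>2"
      unfolding sq[OF t] using zero_le_power2[of "(1 - t) * \<alpha> - t * \<beta>"]
      by (simp only: power2_sum power2_diff)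
    then have "m * sqrt (2 * w * c * (t * (1 - t))) \<le> (1 - t) * \<alpha> + t * \<beta>"
      by (rule power2_le_imp_le) (use t \<alpha> \<beta> in simp)
    then show ?thesis
      using pos[OF t] by (simp add: pos_le_divide_eq)
  qed
  \<comment> \<open>Equality in the inequality of the means requires \<open>(1 - t) * \<alpha> = t * \<beta>\<close>.\<close>
  define t where "t = \<alpha> / (\<alpha> + \<beta>)"
  have t: "0 < t" "t < 1"
    using \<alpha> \<beta> by (simp_all add: t_def)
  have attained: "((1 - t) * \<alpha> + t * \<beta>) / sqrt (2 * w * c * (t * (1 - t))) = m"
  proof -
    have bal: "(1 - t) * \<alpha> = t * \<beta>"
      using \<alpha> \<beta> by (simp add: t_def field_simps)
    have "(m * sqrt (2 * w * c * (t * (1 - t))))\<^sup>2 = ((1 - t) * \<alpha> + t * \<beta>)\<^sup>2"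
      unfolding sq[OF t] bal by (simp add: power2_eq_square)
    then have eq: "m * sqrt (2 * w * c * (t * (1 - t))) = (1 - t) * \<alpha> + t * \<beta>"
      by (rule power2_eq_imp_eq) (use pos[OF t] t \<alpha> \<beta> m1 in auto)
    have "sqrt (2 * w * c * (t * (1 - t))) \<noteq> 0"
      using pos[OF t] by (simp only: real_sqrt_eq_0_iff less_imp_neq[symmetric] not_False_eq_True)
    from eq_divide_imp[OF this eq] show ?thesis
      by (rule sym)
  qed
  have "klein_infdist X (open_segment P Q) = arcosh m"
    unfolding klein_infdist_def seg image_image
  proof (rule cInf_eq_minimum)
    show "arcosh m \<in> (\<lambda>t. klein_dist X (Y t)) ` {0<..<1}"
      using t by (intro image_eqI[of _ _ t]) (simp_all add: dist attained)
  next
    fix d assume "d \<in> (\<lambda>t. klein_dist X (Y t)) ` {0<..<1}"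
    then obtain r where r: "0 < r" "r < 1" and d: "d = klein_dist X (Y r)"
      by auto
    show "arcosh m \<le> d"
      unfolding d dist using lower[OF r] m1
      by (metis arcosh_real_strict_mono order_le_less)
  qed
  then have "sinh (klein_infdist X (open_segment P Q)) = sqrt (m\<^sup>2 - 1)"
    using m1 by (simp add: sinh_arcosh_real)
  then show ?thesis
    by (simp add: m_def)
qed

section \<open>Unit normals of chords\<close>

text \<open>
  Homogeneous coordinates on the projective line treat the point at infinity on the same footing
  as the others.
\<close>

fun homogeneous :: "rp1 \<Rightarrow> real \<times> real" where
  "homogeneous (Affine p) = (1, p)"
| "homogeneous Infinity = (0, 1)"

text \<open>The determinant that extends the difference \<open>p - q\<close> to the point at infinity.\<close>

definition bracket :: "rp1 \<Rightarrow> rp1 \<Rightarrow> real" where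
  "bracket a b = snd (homogeneous a) * fst (homogeneous b) - fst (homogeneous a) * snd (homogeneous b)"

lemma bracket_nonzero: "a \<noteq> b \<Longrightarrow> bracket a b \<noteq> 0"
  by (cases a; cases b) (auto simp: bracket_def)

lemma homogeneous_nonzero: "(fst (homogeneous a))\<^sup>2 + (snd (homogeneous a))\<^sup>2 > 0"
  by (cases a) (auto simp: add_pos_nonneg)

lemma circle_point_homogeneous:
  assumes "homogeneous a = (m, n)"
  shows "circle_point a = ((m\<^sup>2 - n\<^sup>2) / (m\<^sup>2 + n\<^sup>2), 2 * m * n / (m\<^sup>2 + n\<^sup>2))"
  using assms by (cases a) auto

text \<open>
  The time and space parts of the unit normal of a chord, built from the summands of \<open>I\<close>, \<open>J\<close>
  and \<open>K\<close>. Its sign depends on the order of the endpoints.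
\<close>

definition chord_time :: "rp1 \<Rightarrow> rp1 \<Rightarrow> real" where
  "chord_time a b =
     rp1_extend (\<lambda>x y. 1 / (x - y)) a b + rp1_extend (\<lambda>x y. x * y / (x - y)) a b"

definition chord_space :: "rp1 \<Rightarrow> rp1 \<Rightarrow> real \<times> real" where
  "chord_space a b =
     (rp1_extend (\<lambda>x y. 1 / (x - y)) a b - rp1_extend (\<lambda>x y. x * y / (x - y)) a b,
      rp1_extend (\<lambda>x y. (x + y) / (x - y)) a b)"

lemma normal_homogeneous:
  assumes "a \<noteq> b" "homogeneous a = (m, n)" "homogeneous b = (m', n')"
  shows "chord_time a b = (m * m' + n * n') / (n * m' - m * n')"
    and "chord_space a b =
      ((m * m' - n * n') / (n * m' - m * n'), (m * n' + n * m') / (n * m' - m * n'))"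
  using assms
  by (cases a; cases b; auto simp: chord_time_def chord_space_def Lim_summands
        simp flip: add_divide_distrib diff_divide_distrib)+

lemma normal_square:
  assumes "a \<noteq> b"
  shows "(chord_time a b)\<^sup>2 - chord_space a b \<bullet> chord_space a b = -1"
proof -
  obtain m n where a: "homogeneous a = (m, n)" by fastforce
  obtain m' n' where b: "homogeneous b = (m', n')" by fastforce
  note h = a b
  define d where "d = n * m' - m * n'"
  have "d \<noteq> 0"
    using bracket_nonzero[OF assms] h by (simp add: bracket_def d_def)
  moreover have "(m * m' + n * n')\<^sup>2 - (m * m' - n * n')\<^sup>2 - (m * n' + n * m')\<^sup>2 = - d\<^sup>2"
    unfolding d_def by algebra
  ultimately show ?thesis
    unfolding normal_homogeneous[OF assms h] d_def[symmetric]
    by (simp add: power2_eq_square divide_simps)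
qed

text \<open>
  For fixed \<open>X\<close>, consider the symmetric bilinear form on \<open>\<real>\<^sup>2\<close> with the matrix
  \<open>((1 - X\<^sub>1, - X\<^sub>2), (- X\<^sub>2, 1 + X\<^sub>1))\<close>, whose determinant is \<open>1 - \<bar>X\<bar>\<^sup>2\<close>. At the homogeneous
  coordinates of the endpoints its diagonal values are \<open>1 - X \<bullet> P\<close> and \<open>1 - X \<bullet> Q\<close> and its
  off-diagonal value is the product of \<open>(1, X)\<close> with the normal, each up to normalization. The
  formula for the Gram determinant, \<open>A B - C\<^sup>2 = w d\<^sup>2\<close> below, gives the hypothesis of
  \<open>sinh_klein_infdist_chord\<close>.
\<close>

lemma sinh_infdist_side:
  assumes ab: "a \<noteq> b" and X: "norm X < 1"
  shows "sinh (klein_infdist X (open_segment (circle_point a) (circle_point b))) =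
    \<bar>chord_time a b - chord_space a b \<bullet> X\<bar> / sqrt (1 - (norm X)\<^sup>2)"
proof -
  obtain m n where a: "homogeneous a = (m, n)" by fastforce
  obtain m' n' where b: "homogeneous b = (m', n')" by fastforce
  note h = a b
  obtain x y where Xxy: "X = (x, y)" by (cases X)
  define e where "e = m\<^sup>2 + n\<^sup>2"
  define e' where "e' = m'\<^sup>2 + n'\<^sup>2"
  define d where "d = n * m' - m * n'"
  define w where "w = 1 - (norm X)\<^sup>2"
  have e: "e > 0" and e': "e' > 0"
    using homogeneous_nonzero[of a] homogeneous_nonzero[of b] h by (simp_all add: e_def e'_def)
  have d: "d \<noteq> 0"
    using bracket_nonzero[OF ab] h by (simp add: bracket_def d_def)
  have w: "w > 0"
    using X by (simp add: w_def power_less_one_iff)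
  have wxy: "w = 1 - x\<^sup>2 - y\<^sup>2"
    by (simp add: w_def Xxy norm_Pair)
  let ?P = "circle_point a" and ?Q = "circle_point b"
  have P: "?P = ((m\<^sup>2 - n\<^sup>2) / e, 2 * m * n / e)"
    using circle_point_homogeneous[OF h(1)] by (simp add: e_def)
  have Q: "?Q = ((m'\<^sup>2 - n'\<^sup>2) / e', 2 * m' * n' / e')"
    using circle_point_homogeneous[OF h(2)] by (simp add: e'_def)
  have "(m\<^sup>2 - n\<^sup>2)\<^sup>2 + (2 * m * n)\<^sup>2 = e\<^sup>2" "(m'\<^sup>2 - n'\<^sup>2)\<^sup>2 + (2 * m' * n')\<^sup>2 = e'\<^sup>2"
    unfolding e_def e'_def by algebra+
  then have unit: "norm ?P = 1" "norm ?Q = 1"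
    using e e' by (simp_all add: P Q norm_Pair power_divide flip: add_divide_distrib)
  have PQ: "1 - ?P \<bullet> ?Q = 2 * d\<^sup>2 / (e * e')"
  proof -
    have "e * e' - (m\<^sup>2 - n\<^sup>2) * (m'\<^sup>2 - n'\<^sup>2) - 2 * m * n * (2 * m' * n') = 2 * d\<^sup>2"
      unfolding e_def e'_def d_def by algebra
    then show ?thesis
      using e e' by (simp add: P Q divide_simps)
  qed
  have "?P \<noteq> ?Q"
  proof
    assume "?P = ?Q"
    then have "1 - ?P \<bullet> ?Q = 0"
      using unit by (simp add: dot_square_norm)
    then show False
      using PQ d e e' by simp
  qed
  define A where "A = e - (m\<^sup>2 - n\<^sup>2) * x - 2 * m * n * y"
  define B where "B = e' - (m'\<^sup>2 - n'\<^sup>2) * x - 2 * m' * n' * y"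
  define C where "C = (m * m' + n * n') - (m * m' - n * n') * x - (m * n' + n * m') * y"
  have XP: "1 - X \<bullet> ?P = A / e"
    using e by (simp add: Xxy P A_def field_simps)
  have XQ: "1 - X \<bullet> ?Q = B / e'"
    using e' by (simp add: Xxy Q B_def field_simps)
  have L: "chord_time a b - chord_space a b \<bullet> X = C / d"
    unfolding normal_homogeneous[OF ab h] d_def[symmetric]
    by (simp add: Xxy C_def diff_divide_distrib add_divide_distrib algebra_simps)
  have gram: "A * B = w * d\<^sup>2 + C\<^sup>2"
    unfolding A_def B_def C_def wxy d_def e_def e'_def by algebra
  have "2 * (1 - X \<bullet> ?P) * (1 - X \<bullet> ?Q)
      = (1 - (norm X)\<^sup>2) * (1 - ?P \<bullet> ?Q) * (1 + (C / d / sqrt w)\<^sup>2)"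
  proof -
    have "(C / d / sqrt w)\<^sup>2 = C\<^sup>2 / (d\<^sup>2 * w)"
      using w by (simp add: power_divide power_mult_distrib)
    then have "(1 - (norm X)\<^sup>2) * (1 - ?P \<bullet> ?Q) * (1 + (C / d / sqrt w)\<^sup>2)
        = w * (2 * d\<^sup>2 / (e * e')) * (1 + C\<^sup>2 / (d\<^sup>2 * w))"
      by (simp add: PQ w_def)
    also have "\<dots> = 2 * (w * d\<^sup>2 + C\<^sup>2) / (e * e')"
      using w d e e' by (simp add: field_simps)
    finally show ?thesis
      unfolding XP XQ gram[symmetric] by simp
  qed
  from sinh_klein_infdist_chord[OF X unit \<open>?P \<noteq> ?Q\<close> this]
  show ?thesis
    using w by (simp add: L abs_divide abs_mult flip: w_def)
qed

text \<open>
  The product is \<open>1\<close> rather than \<open>-1\<close> because the shared endpoint comes last in one normal and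
  first in the other.
\<close>

lemma normal_product_adjacent:
  assumes "a \<noteq> b" "b \<noteq> c"
  shows "chord_time a b * chord_time b c - chord_space a b \<bullet> chord_space b c = 1"
proof -
  obtain m n where a: "homogeneous a = (m, n)" by fastforce
  obtain m' n' where b: "homogeneous b = (m', n')" by fastforce
  obtain k l where c: "homogeneous c = (k, l)" by fastforce
  note h = a b c
  define d where "d = n * m' - m * n'"
  define f where "f = n' * k - m' * l"
  have "d \<noteq> 0" "f \<noteq> 0"
    using bracket_nonzero[OF assms(1)] bracket_nonzero[OF assms(2)] h
    by (simp_all add: bracket_def d_def f_def)
  moreover have "(m * m' + n * n') * (m' * k + n' * l) - (m * m' - n * n') * (m' * k - n' * l)
      - (m * n' + n * m') * (m' * l + n' * k) = d * f"
    unfolding d_def f_def by algebra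
  ultimately show ?thesis
    unfolding normal_homogeneous[OF assms(1) h(1,2)] normal_homogeneous[OF assms(2) h(2,3)]
      d_def[symmetric] f_def[symmetric]
    by (simp add: divide_simps)
qed

section \<open>The reversed Cauchy-Schwarz inequality\<close>

text \<open>
  \<open>T\<^sup>2\<close> times the difference of the two sides is the sum of squares
  \<open>(T\<^sup>2 - V \<bullet> V) \<bar>T X - V\<bar>\<^sup>2 + (V \<bullet> (T X - V))\<^sup>2\<close>.
\<close>

lemma reversed_Cauchy_Schwarz:
  fixes V X :: "real \<times> real"
  assumes "T\<^sup>2 - V \<bullet> V > 0"
  shows "(T\<^sup>2 - V \<bullet> V) * (1 - X \<bullet> X) \<le> (T - V \<bullet> X)\<^sup>2"
proof -
  obtain u v where V: "V = (u, v)" by (cases V)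
  obtain x y where X: "X = (x, y)" by (cases X)
  have "T\<^sup>2 > 0"
    using assms inner_ge_zero[of V] by linarith
  moreover have "T\<^sup>2 * ((T - V \<bullet> X)\<^sup>2 - (T\<^sup>2 - V \<bullet> V) * (1 - X \<bullet> X))
      = (T\<^sup>2 - V \<bullet> V) * ((T * x - u)\<^sup>2 + (T * y - v)\<^sup>2) + (u * (T * x - u) + v * (T * y - v))\<^sup>2"
    by (simp add: V X) algebra
  moreover have "\<dots> \<ge> 0"
    using assms by simp
  ultimately have "0 \<le> (T - V \<bullet> X)\<^sup>2 - (T\<^sup>2 - V \<bullet> V) * (1 - X \<bullet> X)"
    by (metis mult_le_cancel_left_pos mult_zero_right)
  then show ?thesis
    by simp
qed

section \<open>The minimum\<close>

theorem theorem3p2: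
  fixes p :: "3 \<Rightarrow> rp1"
  assumes "inj p"
  shows "is_arg_min (\<lambda>X. \<Sum>l\<in>UNIV. sinh (klein_infdist X (side p l)))
           (\<lambda>X. X \<in> klein_disc) (S_point p)"
proof -
  define t where "t l = chord_time (p l) (p (l + 1))" for l
  define n where "n l = chord_space (p l) (p (l + 1))" for l
  define T where "T = (\<Sum>l\<in>UNIV. t l)"
  define V where "V = (\<Sum>l\<in>UNIV. n l)"
  have IK: "I_sum p + K_sum p = T"
    by (simp add: I_sum_def K_sum_def T_def t_def chord_time_def sum.distrib)
  have V: "V = (I_sum p - K_sum p, 2 * J_sum p)"
    by (rule prod_eqI)
      (simp_all add: I_sum_def J_sum_def K_sum_def V_def n_def chord_space_def sum_subtractf
        fst_sum snd_sum)
  have T0: "T \<noteq> 0"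
    using I_sum_plus_K_sum_nonzero[OF assms] IK by simp
  have S: "S_point p = (1 / T) *\<^sub>R V"
    by (simp add: S_point_def IK V)
  have four: "p 4 = p 1"
    by (rule arg_cong[where f = p]) simp
  have distinct: "p 1 \<noteq> p 2" "p 2 \<noteq> p 3" "p 3 \<noteq> p 1"
    using assms by (auto dest: injD)
  note sq = normal_square[OF distinct(1)] normal_square[OF distinct(2)] normal_square[OF distinct(3)]
  note adj = normal_product_adjacent[OF distinct(1,2)] normal_product_adjacent[OF distinct(2,3)]
    normal_product_adjacent[OF distinct(3,1)]
  have NN: "T * t l - V \<bullet> n l = 1" for l
  proof -
    have "l \<in> {1, 2, 3}"
      using UNIV_3 by blast
    then show ?thesis
      using sq adj
      by (auto simp: T_def V_def t_def n_def sum_3 four inner_add_left inner_commute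
          power2_eq_square algebra_simps)
  qed
  have square: "T\<^sup>2 - V \<bullet> V = 3"
  proof -
    have "T\<^sup>2 - V \<bullet> V = (\<Sum>l\<in>UNIV. T * t l - V \<bullet> n l)"
      by (simp add: sum_subtractf power2_eq_square T_def V_def inner_sum_right
          flip: sum_distrib_left)
    then show ?thesis
      by (simp add: NN)
  qed
  have objective: "(\<Sum>l\<in>UNIV. sinh (klein_infdist X (side p l)))
      = (\<Sum>l\<in>UNIV. \<bar>t l - n l \<bullet> X\<bar>) / sqrt (1 - (norm X)\<^sup>2)" if "norm X < 1" for X
  proof -
    have "p l \<noteq> p (l + 1)" for l
      using assms by (auto dest: injD)
    then show ?thesis
      using that
      by (simp add: side_def sinh_infdist_side t_def n_def sum_divide_distrib)
  qed
  have lower: "sqrt 3 \<le> (\<Sum>l\<in>UNIV. sinh (klein_infdist X (side p l)))" if X: "norm X < 1" for X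
  proof -
    have w: "1 - (norm X)\<^sup>2 > 0"
      using X by (simp add: power_less_one_iff)
    have "3 * (1 - (norm X)\<^sup>2) \<le> (T - V \<bullet> X)\<^sup>2"
      using reversed_Cauchy_Schwarz[of T V X] square by (simp add: power2_norm_eq_inner)
    then have "sqrt 3 * sqrt (1 - (norm X)\<^sup>2) \<le> \<bar>T - V \<bullet> X\<bar>"
      by (metis real_sqrt_abs real_sqrt_le_mono real_sqrt_mult)
    also have "T - V \<bullet> X = (\<Sum>l\<in>UNIV. t l - n l \<bullet> X)"
      by (simp add: T_def V_def sum_subtractf inner_sum_left)
    also have "\<bar>\<dots>\<bar> \<le> (\<Sum>l\<in>UNIV. \<bar>t l - n l \<bullet> X\<bar>)"
      by (rule sum_abs)
    finally show ?thesis
      using w by (simp add: objective[OF X] pos_le_divide_eq)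
  qed
  have VV: "V \<bullet> V = T\<^sup>2 - 3"
    using square by simp
  have normS: "1 - (norm (S_point p))\<^sup>2 = 3 / T\<^sup>2"
    unfolding power2_norm_eq_inner S
    using T0 by (simp add: VV power2_eq_square diff_divide_distrib)
  have "3 / T\<^sup>2 > 0"
    using T0 by simp
  then have "(norm (S_point p))\<^sup>2 < 1"
    using normS by linarith
  then have disc: "norm (S_point p) < 1"
    by (simp add: power_less_one_iff)
  have "t l - n l \<bullet> S_point p = 1 / T" for l
    using NN[of l] T0 by (simp add: S inner_commute field_simps)
  then have "(\<Sum>l\<in>UNIV. sinh (klein_infdist (S_point p) (side p l))) = 3 * \<bar>1 / T\<bar> / (sqrt 3 / \<bar>T\<bar>)"
    by (simp add: objective[OF disc] normS real_sqrt_divide)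
  also have "\<dots> = sqrt 3"
    using T0 by (simp add: real_div_sqrt)
  finally show ?thesis
    unfolding is_arg_min_linorder klein_disc_def using lower disc by simp
qed

end
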